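(* Let $\vec\sigma=\langle\bar\sigma^\alpha : 1<\alpha<\omega_1\rangle$ be any sequence such that each $\bar\sigma^\alpha=\langle\sigma^\alpha_n : n\in\omega\rangle$ is a sequence of ordinals in $\alpha\setminus 1=\{\xi : 1\le\xi<\alpha\}$ which has supremum $\alpha$ if $\alpha$ is a limit ordinal, and is the constant sequence with value $\alpha-1$ if $\alpha$ is a successor. Then for all ordinals $1\le\alpha<\beta<\omega_1$, $\mathfrak a^{\vec\sigma}_\beta\le\mathfrak a^{\vec\sigma}_\alpha$.
   Context: Work in ZFC. Given $\vec\sigma$ as in the claim, define sets $T^{\vec\sigma}_\alpha$ of finite sequences of natural numbers by recursion on $1\le\alpha<\omega_1$: $T^{\vec\sigma}_1={}^1\omega$ (the sequences of length $1$), and $T^{\vec\sigma}_\alpha=\{\langle n\rangle^\frown t : n\in\omega,\ t\in T^{\vec\sigma}_{\sigma^\alpha_n}\}$ for $\alpha>1$. Let $\mathrm{Fin}^{\vec\sigma,\alpha}$ be the ideal on $T^{\vec\sigma}_\alpha$ defined by recursion as follows: $\mathrm{Fin}^{\vec\sigma,1}$ is the ideal of finite subsets of $T^{\vec\sigma}_1$; for $\alpha>1$ and $X\subseteq T^{\vec\sigma}_\alpha$, $$X\in\mathrm{Fin}^{\vec\sigma,\alpha}\iff\{n\in\omega : \{t : \langle n\rangle^\frown t\in X\}\notin\mathrm{Fin}^{\vec\sigma,\sigma^\alpha_n}\}\text{ is finite}.$$ Let $\mathcal I$ be an ideal on a countable set $S$. An $\mathcal I$-almost disjoint family is a set $\mathcal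 A\subseteq\mathcal P(S)\setminus\mathcal I$ such that $A\cap B\in\mathcal I$ for all distinct $A,B\in\mathcal A$. An $\mathcal I$-mad family is an $\mathcal I$-almost disjoint family that is maximal under inclusion among such families. $\mathfrak a_{\mathcal I}$ is the least cardinality of an infinite $\mathcal I$-mad family, and $\mathfrak a^{\vec\sigma}_\alpha=\mathfrak a_{\mathcal I}$ for $\mathcal I=\mathrm{Fin}^{\vec\sigma,\alpha}$. *)

theory Defs
  imports "HOL-Library.Countable_Set" "HOL-Library.Lub_Glb"
begin

unbundle cardinal_syntax

section \<open>The countable ordinals\<close>

text \<open>
  An element of the type below is an ordinal smaller than the first uncountable ordinal, which
  is rendered as the canonical well-order of type the cardinal successor of the natural numbers.
\<close>

typedef omega1 = "Field (cardSuc natLeq)"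
proof -
  have "infinite (Field (cardSuc natLeq))"
    by (metis Field_natLeq cardSuc_finite infinite_UNIV_nat natLeq_Card_order)
  then show ?thesis by (metis ex_in_conv finite.emptyI)
qed

instantiation omega1 :: wellorder
begin

definition less_eq_omega1 :: "omega1 \<Rightarrow> omega1 \<Rightarrow> bool" where
  "a \<le> b \<longleftrightarrow> (Rep_omega1 a, Rep_omega1 b) \<in> cardSuc natLeq"

definition less_omega1 :: "omega1 \<Rightarrow> omega1 \<Rightarrow> bool" where
  "a < b \<longleftrightarrow> a \<le> b \<and> \<not> b \<le> (a :: omega1)"

instance
proof -
  have W: "wo_rel (cardSuc natLeq)"
    by (simp add: wo_rel_def cardSuc_Well_order natLeq_Card_order)
  have antisym: "x = y" if "x \<le> y" "y \<le> x" for x y :: omega1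
    using wo_rel.ANTISYM[OF W] that
    by (metis Rep_omega1_inject antisymD less_eq_omega1_def)
  have total: "x \<le> y \<or> y \<le> x" for x y :: omega1
    using wo_rel.TOTALS[OF W] Rep_omega1 by (auto simp: less_eq_omega1_def)
  show "OFCLASS(omega1, wellorder_class)"
  proof
    fix x y z :: omega1
    show "x < y \<longleftrightarrow> x \<le> y \<and> \<not> y \<le> x" by (rule less_omega1_def)
    show "x \<le> x" using total[of x x] by simp
    show "x \<le> y \<Longrightarrow> y \<le> z \<Longrightarrow> x \<le> z"
      using wo_rel.TRANS[OF W] unfolding less_eq_omega1_def by (metis transD)
    show "x \<le> y \<Longrightarrow> y \<le> x \<Longrightarrow> x = y" by (rule antisym)
    show "x \<le> y \<or> y \<le> x" by (rule total)
  next
    fix P :: "omega1 \<Rightarrow> bool" and a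
    assume step: "\<And>x. (\<And>y. y < x \<Longrightarrow> P y) \<Longrightarrow> P x"
    have "wf (inv_image (cardSuc natLeq - Id) Rep_omega1)"
      using wo_rel.WF[OF W] by simp
    moreover have "(y, x) \<in> inv_image (cardSuc natLeq - Id) Rep_omega1" if "y < x" for x y
      using that by (auto simp: less_omega1_def less_eq_omega1_def)
    ultimately show "P a"
    proof (induction a rule: wf_induct_rule)
      case (less x)
      then show ?case using step by blast
    qed
  qed
qed

end

lemma uncountable_omega1: "uncountable (UNIV :: omega1 set)"
proof
  assume "countable (UNIV :: omega1 set)"
  then have "countable (range Rep_omega1)" by simp
  then have "countable (Field (cardSuc natLeq))"
    by (simp add: type_definition.Rep_range[OF type_definition_omega1])
  then obtain f :: "nat set \<Rightarrow> nat" where "inj_on f (Field (cardSuc natLeq))"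
    unfolding countable_def by blast
  then have "|Field (cardSuc natLeq)| \<le>o |UNIV :: nat set|"
    by (intro card_of_ordLeq[THEN iffD1]) blast
  then have "|Field (cardSuc natLeq)| \<le>o natLeq"
    using card_of_nat ordLeq_ordIso_trans by blast
  moreover have "|Field (cardSuc natLeq)| =o cardSuc natLeq"
    by (simp add: card_of_Field_ordIso cardSuc_Card_order natLeq_Card_order)
  ultimately have "cardSuc natLeq \<le>o natLeq"
    using ordIso_ordLeq_trans ordIso_symmetric by blast
  then show False
    using cardSuc_greater[OF natLeq_Card_order] not_ordLess_ordLeq by blast
qed

lemma countable_lessThan_omega1: "countable {..<a :: omega1}"
proof -
  let ?r = "cardSuc natLeq"
  have "|underS ?r (Rep_omega1 a)| <o ?r"
    using card_of_underS[OF cardSuc_Card_order[OF natLeq_Card_order] Rep_omega1] .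
  then have "|underS ?r (Rep_omega1 a)| \<le>o natLeq"
    using cardSuc_ordLess_ordLeq[OF natLeq_Card_order card_of_Card_order]
      cardSuc_ordLeq_ordLess[OF natLeq_Card_order card_of_Card_order] by blast
  then have "|underS ?r (Rep_omega1 a)| \<le>o |UNIV :: nat set|"
    using card_of_nat ordIso_symmetric ordLeq_ordIso_trans by blast
  then have "countable (underS ?r (Rep_omega1 a))"
    unfolding countable_def card_of_ordLeq[symmetric] by blast
  moreover have "Rep_omega1 ` {..<a} \<subseteq> underS ?r (Rep_omega1 a)"
    by (auto simp: underS_def less_eq_omega1_def less_omega1_def Rep_omega1_inject)
  ultimately have "countable (Rep_omega1 ` {..<a})"
    using countable_subset by blast
  then show ?thesis
    by (rule countable_image_inj_on) (simp add: inj_on_def Rep_omega1_inject)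
qed

lemma omega1_unbounded:
  obtains b :: omega1 where "a < b"
proof -
  have "countable (insert a {..<a})" by (simp add: countable_lessThan_omega1)
  then have "insert a {..<a} \<noteq> UNIV" using uncountable_omega1 by metis
  then obtain b where "b \<notin> insert a {..<a}" by blast
  then have "a < b" by auto
  then show ?thesis by (rule that)
qed

definition osuc :: "omega1 \<Rightarrow> omega1" where
  "osuc a = (LEAST b. a < b)"

lemma less_osuc: "a < osuc a"
  unfolding osuc_def by (rule omega1_unbounded[of a]) (rule LeastI)

lemma osuc_le: "a < b \<Longrightarrow> osuc a \<le> b"
  unfolding osuc_def by (rule Least_le)

instantiation omega1 :: "{zero, one}"
begin

definition zero_omega1 :: omega1 where "0 = (LEAST a :: omega1. True)"

definition one_omega1 :: omega1 where "1 = osuc 0"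

instance ..

end

lemma zero_le_omega1: "(0 :: omega1) \<le> a"
  unfolding zero_omega1_def by (simp add: Least_le)

definition limit_ordinal :: "omega1 \<Rightarrow> bool" where
  "limit_ordinal a \<longleftrightarrow> a \<noteq> 0 \<and> (\<forall>c. a \<noteq> osuc c)"


section \<open>The ideals\<close>

text \<open>Only the values at indices \<open>\<alpha> > 1\<close> are constrained; the others are never used.\<close>

definition ladder_sequence :: "(omega1 \<Rightarrow> nat \<Rightarrow> omega1) \<Rightarrow> bool" where
  "ladder_sequence \<sigma> \<longleftrightarrow>
    (\<forall>\<alpha>>1. (\<forall>n. 1 \<le> \<sigma> \<alpha> n \<and> \<sigma> \<alpha> n < \<alpha>) \<and>
      (limit_ordinal \<alpha> \<longrightarrow> isLub UNIV (range (\<sigma> \<alpha>)) \<alpha>) \<and>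
      (\<forall>\<gamma>. \<alpha> = osuc \<gamma> \<longrightarrow> (\<forall>n. \<sigma> \<alpha> n = \<gamma>)))"

text \<open>
  The tests \<open>\<sigma> \<alpha> n < \<alpha>\<close> in the two recursions only serve to make the functions total; for a
  ladder sequence they are redundant, and the equations without them are derived below.
  The value at index \<open>0\<close> is irrelevant.
\<close>

function seqs :: "(omega1 \<Rightarrow> nat \<Rightarrow> omega1) \<Rightarrow> omega1 \<Rightarrow> nat list set" where
  "seqs \<sigma> \<alpha> =
    (if \<alpha> = 1 then {t. length t = 1}
     else {n # t | n t. t \<in> (if \<sigma> \<alpha> n < \<alpha> then seqs \<sigma> (\<sigma> \<alpha> n) else {})})"
  by auto
termination
  by (relation "inv_image {(x, y). x < y} snd") (auto simp: wf)

declare seqs.simps [simp del]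

function Fin_ideal :: "(omega1 \<Rightarrow> nat \<Rightarrow> omega1) \<Rightarrow> omega1 \<Rightarrow> nat list set set" where
  "Fin_ideal \<sigma> \<alpha> =
    (if \<alpha> = 1 then {X. X \<subseteq> seqs \<sigma> 1 \<and> finite X}
     else {X. X \<subseteq> seqs \<sigma> \<alpha> \<and>
       finite {n. {t. n # t \<in> X} \<notin> (if \<sigma> \<alpha> n < \<alpha> then Fin_ideal \<sigma> (\<sigma> \<alpha> n) else {})}})"
  by auto
termination
  by (relation "inv_image {(x, y). x < y} snd") (auto simp: wf)

declare Fin_ideal.simps [simp del]

lemma seqs_1: "seqs \<sigma> 1 = {t. length t = 1}"
  by (simp add: seqs.simps)

lemma seqs_rec:
  assumes "ladder_sequence \<sigma>" "1 < \<alpha>"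
  shows "seqs \<sigma> \<alpha> = {n # t | n t. t \<in> seqs \<sigma> (\<sigma> \<alpha> n)}"
  using assms by (subst seqs.simps) (auto simp: ladder_sequence_def)

lemma Fin_ideal_1: "X \<in> Fin_ideal \<sigma> 1 \<longleftrightarrow> X \<subseteq> seqs \<sigma> 1 \<and> finite X"
  by (simp add: Fin_ideal.simps)

lemma Fin_ideal_rec:
  assumes "ladder_sequence \<sigma>" "1 < \<alpha>" "X \<subseteq> seqs \<sigma> \<alpha>"
  shows "X \<in> Fin_ideal \<sigma> \<alpha> \<longleftrightarrow> finite {n. {t. n # t \<in> X} \<notin> Fin_ideal \<sigma> (\<sigma> \<alpha> n)}"
  using assms by (subst Fin_ideal.simps) (auto simp: ladder_sequence_def)

lemma Fin_ideal_subset: "X \<in> Fin_ideal \<sigma> \<alpha> \<Longrightarrow> X \<subseteq> seqs \<sigma> \<alpha>"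
  by (subst (asm) Fin_ideal.simps) (auto split: if_splits)

lemma Fin_ideal_mono:
  assumes "ladder_sequence \<sigma>" "1 \<le> \<alpha>" "Y \<in> Fin_ideal \<sigma> \<alpha>" "X \<subseteq> Y"
  shows "X \<in> Fin_ideal \<sigma> \<alpha>"
  using assms(2-4)
proof (induction \<alpha> arbitrary: X Y rule: less_induct)
  case (less \<alpha>)
  show ?case
  proof (cases "\<alpha> = 1")
    case True
    then show ?thesis using less.prems by (auto simp: Fin_ideal_1 intro: finite_subset)
  next
    case False
    then have \<alpha>: "1 < \<alpha>" using less.prems by simp
    have \<sigma>: "1 \<le> \<sigma> \<alpha> n" "\<sigma> \<alpha> n < \<alpha>" for n
      using assms(1) \<alpha> by (auto simp: ladder_sequence_def)
    have Y: "Y \<subseteq> seqs \<sigma> \<alpha>" using less.prems Fin_ideal_subset by blast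
    have "{n. {t. n # t \<in> X} \<notin> Fin_ideal \<sigma> (\<sigma> \<alpha> n)} \<subseteq> {n. {t. n # t \<in> Y} \<notin> Fin_ideal \<sigma> (\<sigma> \<alpha> n)}"
      using less.IH[OF \<sigma>(2) \<sigma>(1)] less.prems(3) by (smt (verit, best) Collect_mono subsetD)
    then show ?thesis
      using less.prems Y Fin_ideal_rec[OF assms(1) \<alpha>] by (meson finite_subset subset_trans)
  qed
qed

lemma Fin_ideal_Un:
  assumes "ladder_sequence \<sigma>" "1 \<le> \<alpha>" "X \<in> Fin_ideal \<sigma> \<alpha>" "Y \<in> Fin_ideal \<sigma> \<alpha>"
  shows "X \<union> Y \<in> Fin_ideal \<sigma> \<alpha>"
  using assms(2-4)
proof (induction \<alpha> arbitrary: X Y rule: less_induct)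
  case (less \<alpha>)
  show ?case
  proof (cases "\<alpha> = 1")
    case True
    then show ?thesis using less.prems by (auto simp: Fin_ideal_1)
  next
    case False
    then have \<alpha>: "1 < \<alpha>" using less.prems by simp
    have \<sigma>: "1 \<le> \<sigma> \<alpha> n" "\<sigma> \<alpha> n < \<alpha>" for n
      using assms(1) \<alpha> by (auto simp: ladder_sequence_def)
    have sub: "X \<subseteq> seqs \<sigma> \<alpha>" "Y \<subseteq> seqs \<sigma> \<alpha>" using less.prems Fin_ideal_subset by blast+
    let ?B = "\<lambda>Z. {n. {t. n # t \<in> Z} \<notin> Fin_ideal \<sigma> (\<sigma> \<alpha> n)}"
    have "{t. n # t \<in> X \<union> Y} = {t. n # t \<in> X} \<union> {t. n # t \<in> Y}" for n by auto
    then have "?B (X \<union> Y) \<subseteq> ?B X \<union> ?B Y" using less.IH[OF \<sigma>(2) \<sigma>(1)] by auto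
    moreover have "finite (?B X \<union> ?B Y)"
      using less.prems sub Fin_ideal_rec[OF assms(1) \<alpha>] by simp
    ultimately show ?thesis
      using sub Fin_ideal_rec[OF assms(1) \<alpha>] by (meson finite_subset Un_least)
  qed
qed

lemma Fin_ideal_proper:
  assumes "ladder_sequence \<sigma>" "1 \<le> \<alpha>"
  shows "seqs \<sigma> \<alpha> \<notin> Fin_ideal \<sigma> \<alpha>"
  using assms(2)
proof (induction \<alpha> rule: less_induct)
  case (less \<alpha>)
  show ?case
  proof (cases "\<alpha> = 1")
    case True
    have "inj (\<lambda>n :: nat. [n])" by (simp add: inj_def)
    then have "infinite (range (\<lambda>n :: nat. [n]))" by (rule range_inj_infinite)
    moreover have "range (\<lambda>n :: nat. [n]) \<subseteq> seqs \<sigma> 1" by (auto simp: seqs_1)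
    ultimately show ?thesis using True by (auto simp: Fin_ideal_1 dest: finite_subset)
  next
    case False
    then have \<alpha>: "1 < \<alpha>" using less.prems by simp
    have "{t. n # t \<in> seqs \<sigma> \<alpha>} \<notin> Fin_ideal \<sigma> (\<sigma> \<alpha> n)" for n
      using less.IH[of "\<sigma> \<alpha> n"] assms(1) \<alpha> seqs_rec[OF assms(1) \<alpha>]
      by (simp add: ladder_sequence_def)
    then show ?thesis using Fin_ideal_rec[OF assms(1) \<alpha>] by simp
  qed
qed


section \<open>Almost disjointness modulo an ideal\<close>

definition almost_disjoint_family :: "'a set \<Rightarrow> 'a set set \<Rightarrow> 'a set set \<Rightarrow> bool" where
  "almost_disjoint_family S I \<A> \<longleftrightarrow>
    \<A> \<subseteq> Pow S - I \<and> (\<forall>A\<in>\<A>. \<forall>B\<in>\<A>. A \<noteq> B \<longrightarrow> A \<inter> B \<in> I)"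

definition mad_family :: "'a set \<Rightarrow> 'a set set \<Rightarrow> 'a set set \<Rightarrow> bool" where
  "mad_family S I \<A> \<longleftrightarrow>
    almost_disjoint_family S I \<A> \<and>
    (\<forall>\<B>. almost_disjoint_family S I \<B> \<and> \<A> \<subseteq> \<B> \<longrightarrow> \<B> = \<A>)"

text \<open>
  Cardinals are represented by cardinal orders, compared by \<open>\<le>o\<close> and identified up to \<open>=o\<close>.
\<close>

definition is_ad_number :: "'a set \<Rightarrow> 'a set set \<Rightarrow> 'a set rel \<Rightarrow> bool" where
  "is_ad_number S I \<kappa> \<longleftrightarrow>
    Card_order \<kappa> \<and>
    (\<exists>\<A>. infinite \<A> \<and> mad_family S I \<A> \<and> |\<A>| =o \<kappa>) \<and>
    (\<forall>\<A>. infinite \<A> \<and> mad_family S I \<A> \<longrightarrow> \<kappa> \<le>o |\<A>| )"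

definition ad_number :: "'a set \<Rightarrow> 'a set set \<Rightarrow> 'a set rel" where
  "ad_number S I = (SOME \<kappa>. is_ad_number S I \<kappa>)"

lemma is_ad_number_ad_number:
  assumes "infinite \<A>" "mad_family S I \<A>"
  shows "is_ad_number S I (ad_number S I)"
proof -
  let ?R = "{|\<A>| | \<A>. infinite \<A> \<and> mad_family S I \<A>}"
  have "|\<A>| \<in> ?R" using assms by blast
  then have "\<exists>\<kappa>\<in>?R. \<forall>r. r <o \<kappa> \<longrightarrow> r \<notin> ?R"
    by (rule wf_ordLess[unfolded wf_eq_minimal, rule_format])
  then obtain \<kappa> where \<kappa>: "\<kappa> \<in> ?R" "\<forall>r. r <o \<kappa> \<longrightarrow> r \<notin> ?R"
    by (rule bexE)
  then obtain \<A>' where \<A>': "\<kappa> = |\<A>'|" "infinite \<A>'" "mad_family S I \<A>'" by blast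
  have "\<kappa> \<le>o |\<B>|" if "infinite \<B>" "mad_family S I \<B>" for \<B>
  proof -
    have "\<not> |\<B>| <o \<kappa>" using \<kappa>(2) that by blast
    then show ?thesis
      using not_ordLess_iff_ordLeq[OF card_of_Well_order card_of_Well_order]
      unfolding \<A>'(1) by blast
  qed
  then have "is_ad_number S I \<kappa>"
    unfolding is_ad_number_def using \<A>' card_of_refl card_of_Card_order by blast
  then show ?thesis unfolding ad_number_def by (rule someI)
qed

definition \<aa> :: "(omega1 \<Rightarrow> nat \<Rightarrow> omega1) \<Rightarrow> omega1 \<Rightarrow> nat list set rel" where
  "\<aa> \<sigma> \<alpha> = ad_number (seqs \<sigma> \<alpha>) (Fin_ideal \<sigma> \<alpha>)"

end

(* For alpha <= beta the ideal of index alpha is, up to restriction to a positive set, a projection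
   of the ideal of index beta: for alpha = 1 project to the first coordinate; for 1 < alpha < beta
   choose distinct indices h n with sigma^alpha_n <= sigma^beta_(h n) and recursively project
   the (h n)-th section to the n-th section.  Preimages of an infinite mad family under such a
   projection, together with the complement of its domain, form an infinite mad family. *)
theory Submission
  imports Defs
begin

section \<open>Positive sets and maximality of almost disjoint families\<close>

lemma almost_disjoint_familyI:
  assumes "\<And>A. A \<in> \<A> \<Longrightarrow> A \<subseteq> S \<and> A \<notin> I"
    and "\<And>A B. A \<in> \<A> \<Longrightarrow> B \<in> \<A> \<Longrightarrow> A \<noteq> B \<Longrightarrow> A \<inter> B \<in> I"
  shows "almost_disjoint_family S I \<A>"
  using assms unfolding almost_disjoint_family_def by auto

lemma almost_disjoint_familyD:
  assumes "almost_disjoint_family S I \<A>" "A \<in> \<A>"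
  shows "A \<subseteq> S" "A \<notin> I" "B \<in> \<A> \<Longrightarrow> A \<noteq> B \<Longrightarrow> A \<inter> B \<in> I"
  using assms unfolding almost_disjoint_family_def by auto

text \<open>If \<open>X\<close> belongs to a larger almost disjoint family, it is positive and so
  meets some \<open>A\<close> of the given family in a positive set. Both lie in the larger family,
  which forces \<open>X = A\<close>.\<close>

lemma mad_familyI:
  assumes "almost_disjoint_family S I \<A>"
    and "\<And>X. X \<subseteq> S \<Longrightarrow> X \<notin> I \<Longrightarrow> \<exists>A\<in>\<A>. X \<inter> A \<notin> I"
  shows "mad_family S I \<A>"
  unfolding mad_family_def
proof (intro conjI allI impI)
  fix \<B> assume "almost_disjoint_family S I \<B> \<and> \<A> \<subseteq> \<B>"
  then have \<B>: "almost_disjoint_family S I \<B>" "\<A> \<subseteq> \<B>" by simp_all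
  have "X \<in> \<A>" if X: "X \<in> \<B>" for X
  proof -
    obtain A where A: "A \<in> \<A>" "X \<inter> A \<notin> I"
      using assms(2) almost_disjoint_familyD(1,2)[OF \<B>(1) X] by blast
    then have "X = A" using almost_disjoint_familyD(3)[OF \<B>(1) X] \<B>(2) by auto
    then show ?thesis using A(1) by simp
  qed
  then show "\<B> = \<A>" using \<B>(2) by auto
qed (rule assms(1))

text \<open>Otherwise \<open>X\<close> could be added to the family. Maximality would make it a
  member already, and then \<open>X \<inter> X = X\<close> would lie in \<open>I\<close>.\<close>

lemma mad_family_meets:
  assumes \<A>: "mad_family S I \<A>" and X: "X \<subseteq> S" "X \<notin> I"
  shows "\<exists>A\<in>\<A>. A \<inter> X \<notin> I"
proof (rule ccontr)
  assume "\<not> (\<exists>A\<in>\<A>. A \<inter> X \<notin> I)"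
  then have *: "A \<inter> X \<in> I" if "A \<in> \<A>" for A using that by simp
  have ad: "almost_disjoint_family S I \<A>" using \<A> unfolding mad_family_def by simp
  have "almost_disjoint_family S I (insert X \<A>)"
  proof (rule almost_disjoint_familyI)
    show "A \<subseteq> S \<and> A \<notin> I" if "A \<in> insert X \<A>" for A
      using that X almost_disjoint_familyD(1,2)[OF ad] by auto
    show "A \<inter> B \<in> I" if "A \<in> insert X \<A>" "B \<in> insert X \<A>" "A \<noteq> B" for A B
      using that * almost_disjoint_familyD(3)[OF ad] by (auto simp: Int_commute)
  qed
  then have "insert X \<A> = \<A>" using \<A> unfolding mad_family_def by auto
  then have "X \<in> \<A>" by blast
  then show False using *[of X] X(2) by simp
qed

text \<open>Zorn's lemma applies: any two sets from the union of a chain lie together in one family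
  of the chain, so the union is again almost disjoint.\<close>

lemma mad_family_extends:
  assumes "almost_disjoint_family S I \<A>"
  obtains \<B> where "\<A> \<subseteq> \<B>" "mad_family S I \<B>"
proof -
  let ?P = "{\<B>. almost_disjoint_family S I \<B> \<and> \<A> \<subseteq> \<B>}"
  have "\<exists>M\<in>?P. \<forall>X\<in>?P. M \<subseteq> X \<longrightarrow> X = M"
  proof (rule subset_Zorn_nonempty)
    show "?P \<noteq> {}" using assms by blast
  next
    fix \<C> assume \<C>: "\<C> \<noteq> {}" "subset.chain ?P \<C>"
    have ad: "almost_disjoint_family S I \<B>" "\<A> \<subseteq> \<B>" if "\<B> \<in> \<C>" for \<B>
      using \<C>(2) that unfolding subset_chain_def by auto
    have "almost_disjoint_family S I (\<Union>\<C>)"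
    proof (rule almost_disjoint_familyI)
      show "A \<subseteq> S \<and> A \<notin> I" if "A \<in> \<Union>\<C>" for A
        using that ad(1) almost_disjoint_familyD(1,2) by (metis UnionE)
    next
      fix A B assume AB: "A \<in> \<Union>\<C>" "B \<in> \<Union>\<C>" "A \<noteq> B"
      then obtain \<B>1 \<B>2 where "\<B>1 \<in> \<C>" "A \<in> \<B>1" "\<B>2 \<in> \<C>" "B \<in> \<B>2" by auto
      moreover from this have "\<B>1 \<subseteq> \<B>2 \<or> \<B>2 \<subseteq> \<B>1"
        using \<C>(2) unfolding subset_chain_def by blast
      ultimately obtain \<B> where "\<B> \<in> \<C>" "A \<in> \<B>" "B \<in> \<B>" by auto
      then show "A \<inter> B \<in> I" using almost_disjoint_familyD(3)[OF ad(1)] AB(3) by simp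
    qed
    moreover have "\<A> \<subseteq> \<Union>\<C>" using \<C>(1) ad(2) by auto
    ultimately show "\<Union>\<C> \<in> ?P" by simp
  qed
  then obtain M where "M \<in> ?P" "\<forall>X\<in>?P. M \<subseteq> X \<longrightarrow> X = M" by (rule bexE)
  then show ?thesis by (intro that[of M]) (auto simp: mad_family_def)
qed

section \<open>Pulling mad families back along a partial projection\<close>

text \<open>
  \<open>F\<close> plays the role of the preimage map of a partial projection from \<open>S'\<close> to \<open>S\<close> with
  domain \<open>F S\<close>.
\<close>

definition pullback_map ::
  "'a set \<Rightarrow> 'a set set \<Rightarrow> 'b set \<Rightarrow> 'b set set \<Rightarrow> ('a set \<Rightarrow> 'b set) \<Rightarrow> bool" where
  "pullback_map S I S' I' F \<longleftrightarrow>
    (\<forall>A\<subseteq>S. F A \<subseteq> S' \<and> (F A \<in> I' \<longleftrightarrow> A \<in> I)) \<and>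
    (\<forall>A\<subseteq>S. \<forall>B\<subseteq>S. F (A \<inter> B) = F A \<inter> F B) \<and>
    (\<forall>X\<subseteq>F S. X \<notin> I' \<longrightarrow> (\<exists>B\<subseteq>S. B \<notin> I \<and> (\<forall>A\<subseteq>S. A \<inter> B \<notin> I \<longrightarrow> X \<inter> F A \<notin> I')))"

lemma pullback_mapI:
  assumes "\<And>A. A \<subseteq> S \<Longrightarrow> F A \<subseteq> S'"
    and "\<And>A. A \<subseteq> S \<Longrightarrow> F A \<in> I' \<longleftrightarrow> A \<in> I"
    and "\<And>A B. A \<subseteq> S \<Longrightarrow> B \<subseteq> S \<Longrightarrow> F (A \<inter> B) = F A \<inter> F B"
    and "\<And>X. X \<subseteq> F S \<Longrightarrow> X \<notin> I' \<Longrightarrow>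
      \<exists>B\<subseteq>S. B \<notin> I \<and> (\<forall>A\<subseteq>S. A \<inter> B \<notin> I \<longrightarrow> X \<inter> F A \<notin> I')"
  shows "pullback_map S I S' I' F"
  unfolding pullback_map_def by (intro conjI allI impI assms)

lemma pullback_mapD:
  assumes "pullback_map S I S' I' F"
  shows "A \<subseteq> S \<Longrightarrow> F A \<subseteq> S'"
    and "A \<subseteq> S \<Longrightarrow> F A \<in> I' \<longleftrightarrow> A \<in> I"
    and "A \<subseteq> S \<Longrightarrow> B \<subseteq> S \<Longrightarrow> F (A \<inter> B) = F A \<inter> F B"
    and "A \<subseteq> S \<Longrightarrow> F A \<subseteq> F S"
    and "X \<subseteq> F S \<Longrightarrow> X \<notin> I' \<Longrightarrow>
      \<exists>B\<subseteq>S. B \<notin> I \<and> (\<forall>A\<subseteq>S. A \<inter> B \<notin> I \<longrightarrow> X \<inter> F A \<notin> I')"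
proof -
  note def = assms[unfolded pullback_map_def]
  show sub: "F A \<subseteq> S'" if "A \<subseteq> S" for A using def[THEN conjunct1] that by simp
  show "F A \<in> I' \<longleftrightarrow> A \<in> I" if "A \<subseteq> S" using def[THEN conjunct1] that by simp
  show Int: "F (A \<inter> B) = F A \<inter> F B" if "A \<subseteq> S" "B \<subseteq> S" for A B
    using def[THEN conjunct2, THEN conjunct1] that by simp
  \<comment> \<open>Monotonicity comes from commuting with intersections:
    \<open>A = A \<inter> S\<close> gives \<open>F A = F A \<inter> F S\<close>.\<close>
  show "F A \<subseteq> F S" if "A \<subseteq> S"
    using Int[OF that order_refl] that by (simp add: inf.absorb1 inf.absorb_iff1)
  show "\<exists>B\<subseteq>S. B \<notin> I \<and> (\<forall>A\<subseteq>S. A \<inter> B \<notin> I \<longrightarrow> X \<inter> F A \<notin> I')" if "X \<subseteq> F S" "X \<notin> I'"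
    using def[THEN conjunct2, THEN conjunct2] that by simp
qed

text \<open>The sets \<open>F A\<close> stay positive and almost disjoint because \<open>F\<close>
  preserves intersections and both preserves and reflects membership in the ideal. For maximality, a
  positive \<open>X\<close> either has a positive part outside \<open>F S\<close>, which the
  complement of \<open>F S\<close> catches, or a positive part inside. In the latter case the last
  clause of \<open>pullback_map\<close> supplies a positive shadow \<open>B\<close> of
  \<open>X\<close> on \<open>S\<close>; some \<open>A\<close> of the family meets \<open>B\<close>
  positively, and then \<open>F A\<close> meets \<open>X\<close> positively.\<close>

lemma mad_family_pullback:
  assumes F: "pullback_map S I S' I' F"
    and mono: "\<And>X Y. Y \<in> I' \<Longrightarrow> X \<subseteq> Y \<Longrightarrow> X \<in> I'"
    and Un: "\<And>X Y. X \<in> I' \<Longrightarrow> Y \<in> I' \<Longrightarrow> X \<union> Y \<in> I'"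
    and \<A>: "infinite \<A>" "mad_family S I \<A>"
  obtains \<B> where "infinite \<B>" "mad_family S' I' \<B>" "|\<B>| \<le>o |\<A>|"
proof -
  note F = pullback_mapD[OF F]
  have A: "A \<subseteq> S" "A \<notin> I" if "A \<in> \<A>" for A
    using \<A>(2) that unfolding mad_family_def almost_disjoint_family_def by blast+
  have disj: "F A \<inter> F B \<in> I'" if "A \<in> \<A>" "B \<in> \<A>" "A \<noteq> B" for A B
  proof -
    have "A \<inter> B \<in> I"
      using \<A>(2) that unfolding mad_family_def almost_disjoint_family_def by blast
    moreover have "A \<inter> B \<subseteq> S" using A(1)[OF that(1)] by blast
    ultimately show ?thesis using F(2)[of "A \<inter> B"] F(3) A that by simp
  qed
  \<comment> \<open>If distinct members had the same image, that image would equal an intersection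
    lying in \<open>I'\<close>, although it is positive.\<close>
  have inj: "inj_on F \<A>"
    by (rule inj_onI) (metis A F(2) disj inf.idem)
  \<comment> \<open>The empty set is below the intersection of the images of two distinct members,
    hence in \<open>I'\<close> by downward closure.\<close>
  obtain A B where "A \<in> \<A>" "B \<in> \<A>" "A \<noteq> B"
    using \<A>(1) by (metis finite.emptyI finite.insertI finite_subset insertI1 subsetI ex_in_conv insert_iff)
  then have empty: "{} \<in> I'" using disj mono by blast
  \<comment> \<open>Subtracting \<open>I'\<close> keeps the complement of the domain only when it is
    positive, as every member of an almost disjoint family must be.\<close>
  define \<B> where "\<B> = F ` \<A> \<union> ({S' - F S} - I')"
  have "infinite \<B>" unfolding \<B>_def using \<A>(1) inj by (simp add: finite_image_iff)
  moreover have "mad_family S' I' \<B>"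
  proof (rule mad_familyI)
    have "X \<inter> Y \<in> I'" if XY: "X \<in> \<B>" "Y \<in> \<B>" "X \<noteq> Y" for X Y
    proof -
      have cases: "(\<exists>A\<in>\<A>. Z = F A) \<or> Z = S' - F S" if "Z \<in> \<B>" for Z
        using that unfolding \<B>_def by blast
      have "F A \<inter> (S' - F S) = {}" "(S' - F S) \<inter> F A = {}" if "A \<in> \<A>" for A
        using F(4)[OF A(1)[OF that]] by blast+
      then show ?thesis using cases[OF XY(1)] cases[OF XY(2)] XY(3) disj empty by metis
    qed
    moreover have "\<B> \<subseteq> Pow S' - I'" unfolding \<B>_def using F(1,2) A by auto
    ultimately show "almost_disjoint_family S' I' \<B>"
      unfolding almost_disjoint_family_def by blast
  next
    fix X assume X: "X \<subseteq> S'" "X \<notin> I'"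
    show "\<exists>B\<in>\<B>. X \<inter> B \<notin> I'"
    proof (cases "X \<inter> (S' - F S) \<in> I'")
      case True
      moreover have "X = (X \<inter> F S) \<union> (X \<inter> (S' - F S))" using X(1) by blast
      ultimately have "X \<inter> F S \<notin> I'" using X(2) Un by metis
      then obtain B where B: "B \<subseteq> S" "B \<notin> I"
        "\<And>A. A \<subseteq> S \<Longrightarrow> A \<inter> B \<notin> I \<Longrightarrow> X \<inter> F S \<inter> F A \<notin> I'"
        using F(5)[of "X \<inter> F S"] by auto
      obtain A where A': "A \<in> \<A>" "A \<inter> B \<notin> I" using mad_family_meets[OF \<A>(2) B(1,2)] ..
      have "X \<inter> F S \<inter> F A \<notin> I'" using B(3)[OF A(1)[OF A'(1)] A'(2)] .
      then have "X \<inter> F A \<notin> I'" using mono[where Y = "X \<inter> F A" and X = "X \<inter> F S \<inter> F A"] by auto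
      then show ?thesis using A'(1) unfolding \<B>_def by blast
    next
      case False
      then have "S' - F S \<notin> I'" using mono[where Y = "S' - F S" and X = "X \<inter> (S' - F S)"] by auto
      then show ?thesis using False unfolding \<B>_def by blast
    qed
  qed
  \<comment> \<open>At most one set is added to an image of an infinite family, so the cardinality
    does not grow.\<close>
  moreover have "|\<B>| \<le>o |\<A>|"
    unfolding \<B>_def
  proof (rule card_of_Un_ordLeq_infinite_Field[OF _ card_of_image _ card_of_Card_order])
    show "infinite (Field |\<A>| )" using \<A>(1) by (simp add: Field_card_of)
    have "\<A> \<noteq> {}" using \<A>(1) by auto
    then have "|{S' - F S}| \<le>o |\<A>|" by (rule card_of_singl_ordLeq)
    then show "|{S' - F S} - I'| \<le>o |\<A>|"
      using card_of_mono1[of "{S' - F S} - I'"] ordLeq_transitive by blast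
  qed
  ultimately show ?thesis by (rule that)
qed

section \<open>Terms of a ladder sequence above a given ordinal\<close>

lemma osuc_cases:
  assumes "1 < \<beta>"
  obtains "limit_ordinal \<beta>" | \<gamma> where "\<beta> = osuc \<gamma>"
  using assms zero_le_omega1[of 1] unfolding limit_ordinal_def by fastforce

lemma ladder_sequence_bounds:
  assumes "ladder_sequence \<sigma>" "1 < \<alpha>"
  shows "1 \<le> \<sigma> \<alpha> n" "\<sigma> \<alpha> n < \<alpha>"
  using assms by (auto simp: ladder_sequence_def)

text \<open>At a limit, finitely many such terms would leave the whole sequence bounded strictly
  below its supremum. At a successor every term is the predecessor, which is at least
  \<open>\<alpha>\<close>.\<close>

lemma ladder_sequence_infinite_above:
  assumes \<sigma>: "ladder_sequence \<sigma>" and \<beta>: "1 < \<beta>" and "\<alpha> < \<beta>"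
  shows "infinite {m. \<alpha> \<le> \<sigma> \<beta> m}"
  using \<beta>
proof (cases rule: osuc_cases)
  case 1
  show ?thesis
  proof
    assume fin: "finite {m. \<alpha> \<le> \<sigma> \<beta> m}"
    \<comment> \<open>Inserting \<open>\<alpha>\<close> makes the set nonempty and lets the maximum
      also bound the terms that lie below \<open>\<alpha>\<close>.\<close>
    define \<delta> where "\<delta> = Max (insert \<alpha> (\<sigma> \<beta> ` {m. \<alpha> \<le> \<sigma> \<beta> m}))"
    have "\<delta> < \<beta>"
      unfolding \<delta>_def using fin assms(3) ladder_sequence_bounds[OF \<sigma> \<beta>] by auto
    have "\<sigma> \<beta> m \<le> \<delta>" for m
    proof (cases "\<alpha> \<le> \<sigma> \<beta> m")
      case True
      then show ?thesis unfolding \<delta>_def using fin by (intro Max_ge) auto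
    next
      case False
      moreover have "\<alpha> \<le> \<delta>" unfolding \<delta>_def using fin by (intro Max_ge) auto
      ultimately show ?thesis by simp
    qed
    moreover have "isLub UNIV (range (\<sigma> \<beta>)) \<beta>"
      using \<sigma> \<beta> 1 unfolding ladder_sequence_def by blast
    ultimately have "\<beta> \<le> \<delta>"
      by (intro isLub_le_isUb) (auto simp: isUb_def setle_def)
    then show False using \<open>\<delta> < \<beta>\<close> by simp
  qed
next
  case (2 \<gamma>)
  then have "\<alpha> \<le> \<gamma>" using assms(3) osuc_le[of \<gamma> \<alpha>] by (meson leD not_le)
  moreover have "\<sigma> \<beta> m = \<gamma>" for m using \<sigma> \<beta> 2 unfolding ladder_sequence_def by blast
  ultimately show ?thesis by simp
qed

section \<open>Projections between the ideals\<close>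

lemma empty_in_Fin_ideal:
  assumes "ladder_sequence \<sigma>" "1 \<le> \<alpha>"
  shows "{} \<in> Fin_ideal \<sigma> \<alpha>"
  using assms(2)
proof (induction \<alpha> rule: less_induct)
  case (less \<alpha>)
  show ?case
  proof (cases "\<alpha> = 1")
    case False
    then have "1 < \<alpha>" using less.prems by simp
    then show ?thesis
      using less.IH ladder_sequence_bounds[OF assms(1), of \<alpha>] Fin_ideal_rec[OF assms(1), of \<alpha>] by simp
  qed (simp add: Fin_ideal_1)
qed

text \<open>This is the preimage map of the projection from \<open>m # t\<close> to
  \<open>[m]\<close>. Each section of a preimage is either a full set of sequences, which is
  positive, or empty, which is not; so a preimage is positive exactly when infinitely many
  \<open>[m]\<close> lie in \<open>A\<close>.\<close>

lemma pullback_map_first_coordinate: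
  assumes \<sigma>: "ladder_sequence \<sigma>" and \<beta>: "1 < \<beta>"
  shows "pullback_map (seqs \<sigma> 1) (Fin_ideal \<sigma> 1) (seqs \<sigma> \<beta>) (Fin_ideal \<sigma> \<beta>)
    (\<lambda>A. {m # t | m t. [m] \<in> A \<and> t \<in> seqs \<sigma> (\<sigma> \<beta> m)})"
    (is "pullback_map _ _ _ _ ?F")
proof -
  note rec = Fin_ideal_rec[OF \<sigma> \<beta>]
  note b = ladder_sequence_bounds[OF \<sigma> \<beta>]
  \<comment> \<open>Identifying \<open>[n]\<close> with \<open>n\<close> turns positivity at index 1
    into infinity of a set of numbers, the form in which the recursive clause at
    \<open>\<beta>\<close> is stated.\<close>
  have finite_iff: "A \<in> Fin_ideal \<sigma> 1 \<longleftrightarrow> finite {n. [n] \<in> A}" if "A \<subseteq> seqs \<sigma> 1" for A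
  proof -
    have "A = (\<lambda>n. [n]) ` {n. [n] \<in> A}"
      using that by (auto simp: seqs_1 image_iff length_Suc_conv subset_iff)
    then have "finite A \<longleftrightarrow> finite {n. [n] \<in> A}"
      by (metis finite_imageI finite_vimageI inj_on_def list.inject vimage_def)
    then show ?thesis using that by (simp add: Fin_ideal_1)
  qed
  have sub: "?F A \<subseteq> seqs \<sigma> \<beta>" for A
    by (auto simp: seqs_rec[OF \<sigma> \<beta>])
  have sec: "{t. n # t \<in> ?F A} = (if [n] \<in> A then seqs \<sigma> (\<sigma> \<beta> n) else {})" for n A
    by auto
  have positive: "?F A \<in> Fin_ideal \<sigma> \<beta> \<longleftrightarrow> A \<in> Fin_ideal \<sigma> 1" if "A \<subseteq> seqs \<sigma> 1" for A
    unfolding rec[OF sub] sec finite_iff[OF that]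
    using Fin_ideal_proper[OF \<sigma> b(1)] empty_in_Fin_ideal[OF \<sigma> b(1)] by (simp add: if_distrib)
  have Int: "?F (A \<inter> B) = ?F A \<inter> ?F B" for A B
    by auto
  have shadow: "\<exists>B\<subseteq>seqs \<sigma> 1. B \<notin> Fin_ideal \<sigma> 1 \<and>
      (\<forall>A\<subseteq>seqs \<sigma> 1. A \<inter> B \<notin> Fin_ideal \<sigma> 1 \<longrightarrow> X \<inter> ?F A \<notin> Fin_ideal \<sigma> \<beta>)"
    if X: "X \<subseteq> ?F (seqs \<sigma> 1)" "X \<notin> Fin_ideal \<sigma> \<beta>" for X
  proof -
    have XS: "X \<subseteq> seqs \<sigma> \<beta>" using X(1) sub by blast
    \<comment> \<open>The shadow of \<open>X\<close> collects the first coordinates with a positive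
      section. Over \<open>A \<inter> B\<close>, intersecting with the preimage of \<open>A\<close>
      leaves these sections unchanged.\<close>
    define B where "B = {[n] | n. {t. n # t \<in> X} \<notin> Fin_ideal \<sigma> (\<sigma> \<beta> n)}"
    have B: "B \<subseteq> seqs \<sigma> 1" "{n. [n] \<in> B} = {n. {t. n # t \<in> X} \<notin> Fin_ideal \<sigma> (\<sigma> \<beta> n)}"
      unfolding B_def by (auto simp: seqs_1)
    have "B \<notin> Fin_ideal \<sigma> 1"
      using X(2) unfolding finite_iff[OF B(1)] B(2) rec[OF XS] .
    moreover have "X \<inter> ?F A \<notin> Fin_ideal \<sigma> \<beta>"
      if A: "A \<subseteq> seqs \<sigma> 1" "A \<inter> B \<notin> Fin_ideal \<sigma> 1" for A
    proof -
      have "infinite {n. [n] \<in> A \<inter> B}"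
        using A finite_iff[of "A \<inter> B"] by blast
      moreover have "{n. [n] \<in> A \<inter> B} \<subseteq>
          {n. {t. n # t \<in> X \<inter> ?F A} \<notin> Fin_ideal \<sigma> (\<sigma> \<beta> n)}"
      proof
        fix n assume n: "n \<in> {n. [n] \<in> A \<inter> B}"
        have "{t. n # t \<in> X \<inter> ?F A} = {t. n # t \<in> X}" using n X(1) by auto
        then show "n \<in> {n. {t. n # t \<in> X \<inter> ?F A} \<notin> Fin_ideal \<sigma> (\<sigma> \<beta> n)}"
          using n unfolding B_def by simp
      qed
      moreover have "X \<inter> ?F A \<subseteq> seqs \<sigma> \<beta>" using XS by blast
      ultimately show ?thesis using rec finite_subset by blast
    qed
    ultimately show ?thesis using B(1) by blast
  qed
  show ?thesis by (rule pullback_mapI[OF sub positive Int shadow])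
qed

text \<open>The projections behind the maps \<open>G n\<close> are glued: the section at
  \<open>h n\<close> is projected to the section at \<open>n\<close>. Injectivity of
  \<open>h\<close> keeps the sections apart, so that the section of the glued preimage at
  \<open>h n\<close> is exactly \<open>G n\<close> of the section of \<open>A\<close> at
  \<open>n\<close>, and all three clauses can be checked section by section.\<close>

lemma pullback_map_sections:
  assumes \<sigma>: "ladder_sequence \<sigma>" and \<alpha>: "1 < \<alpha>" and \<beta>: "1 < \<beta>" and h: "inj h"
    and G: "\<And>n. pullback_map (seqs \<sigma> (\<sigma> \<alpha> n)) (Fin_ideal \<sigma> (\<sigma> \<alpha> n))
      (seqs \<sigma> (\<sigma> \<beta> (h n))) (Fin_ideal \<sigma> (\<sigma> \<beta> (h n))) (G n)"
  shows "pullback_map (seqs \<sigma> \<alpha>) (Fin_ideal \<sigma> \<alpha>) (seqs \<sigma> \<beta>) (Fin_ideal \<sigma> \<beta>)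
    (\<lambda>A. {h n # t | n t. t \<in> G n {s. n # s \<in> A}})"
    (is "pullback_map _ _ _ _ ?F")
proof -
  note rec\<alpha> = Fin_ideal_rec[OF \<sigma> \<alpha>] and rec\<beta> = Fin_ideal_rec[OF \<sigma> \<beta>]
  note G = pullback_mapD[OF G]
  have sec\<alpha>: "{s. n # s \<in> A} \<subseteq> seqs \<sigma> (\<sigma> \<alpha> n)" if "A \<subseteq> seqs \<sigma> \<alpha>" for A n
    using that by (auto simp: seqs_rec[OF \<sigma> \<alpha>])
  have sub: "?F A \<subseteq> seqs \<sigma> \<beta>" if "A \<subseteq> seqs \<sigma> \<alpha>" for A
    using G(1)[OF sec\<alpha>[OF that]] by (auto simp: seqs_rec[OF \<sigma> \<beta>])
  have sec: "{t. h n # t \<in> ?F A} = G n {s. n # s \<in> A}" for n A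
    using h by (auto simp: inj_eq)
  \<comment> \<open>Within the domain, sections at indices outside the range of \<open>h\<close> are
    empty. The positive sections are therefore indexed through \<open>h\<close>, and injectivity
    preserves finiteness of the index set.\<close>
  have positive_iff: "X \<notin> Fin_ideal \<sigma> \<beta> \<longleftrightarrow>
      infinite {n. {t. h n # t \<in> X} \<notin> Fin_ideal \<sigma> (\<sigma> \<beta> (h n))}"
    if X: "X \<subseteq> ?F (seqs \<sigma> \<alpha>)" for X
  proof -
    have "m \<in> range h" if m: "{t. m # t \<in> X} \<notin> Fin_ideal \<sigma> (\<sigma> \<beta> m)" for m
    proof -
      have "{t. m # t \<in> X} \<noteq> {}"
        using m empty_in_Fin_ideal[OF \<sigma> ladder_sequence_bounds(1)[OF \<sigma> \<beta>]] by metis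
      then show ?thesis using X by auto
    qed
    then have "{m. {t. m # t \<in> X} \<notin> Fin_ideal \<sigma> (\<sigma> \<beta> m)} =
        h ` {n. {t. h n # t \<in> X} \<notin> Fin_ideal \<sigma> (\<sigma> \<beta> (h n))}"
      by auto
    moreover have "X \<subseteq> seqs \<sigma> \<beta>" using X sub[OF order_refl] by blast
    ultimately show ?thesis
      using rec\<beta>[of X] h by (simp add: finite_image_iff inj_on_subset)
  qed
  have mono: "?F A \<subseteq> ?F (seqs \<sigma> \<alpha>)" if "A \<subseteq> seqs \<sigma> \<alpha>" for A
  proof -
    have "{s. n # s \<in> seqs \<sigma> \<alpha>} = seqs \<sigma> (\<sigma> \<alpha> n)" for n by (auto simp: seqs_rec[OF \<sigma> \<alpha>])
    then show ?thesis using G(4)[OF sec\<alpha>[OF that]] by (simp del: Collect_mono_iff) blast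
  qed
  have positive: "?F A \<in> Fin_ideal \<sigma> \<beta> \<longleftrightarrow> A \<in> Fin_ideal \<sigma> \<alpha>" if "A \<subseteq> seqs \<sigma> \<alpha>" for A
    using positive_iff[OF mono[OF that]] rec\<alpha>[OF that] G(2)[OF sec\<alpha>[OF that]] unfolding sec by simp
  have Int: "?F (A \<inter> B) = ?F A \<inter> ?F B" if "A \<subseteq> seqs \<sigma> \<alpha>" "B \<subseteq> seqs \<sigma> \<alpha>" for A B
  proof -
    have "G n {s. n # s \<in> A \<inter> B} = G n {s. n # s \<in> A} \<inter> G n {s. n # s \<in> B}" for n
      using G(3)[OF sec\<alpha>[OF that(1)] sec\<alpha>[OF that(2)], of n] by (simp add: Collect_conj_eq)
    then have "?F (A \<inter> B) =
        {h n # t | n t. t \<in> G n {s. n # s \<in> A} \<and> t \<in> G n {s. n # s \<in> B}}"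
      by (simp only: Int_iff)
    also have "\<dots> = ?F A \<inter> ?F B" using h by (auto simp: inj_eq)
    finally show ?thesis .
  qed
  have shadow: "\<exists>B\<subseteq>seqs \<sigma> \<alpha>. B \<notin> Fin_ideal \<sigma> \<alpha> \<and>
      (\<forall>A\<subseteq>seqs \<sigma> \<alpha>. A \<inter> B \<notin> Fin_ideal \<sigma> \<alpha> \<longrightarrow> X \<inter> ?F A \<notin> Fin_ideal \<sigma> \<beta>)"
    if X: "X \<subseteq> ?F (seqs \<sigma> \<alpha>)" "X \<notin> Fin_ideal \<sigma> \<beta>" for X
  proof -
    define N where "N = {n. {t. h n # t \<in> X} \<notin> Fin_ideal \<sigma> (\<sigma> \<beta> (h n))}"
    have N: "infinite N" using positive_iff[OF X(1)] X(2) unfolding N_def by blast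
    have "\<exists>B. n \<in> N \<longrightarrow> B \<subseteq> seqs \<sigma> (\<sigma> \<alpha> n) \<and> B \<notin> Fin_ideal \<sigma> (\<sigma> \<alpha> n) \<and>
        (\<forall>A\<subseteq>seqs \<sigma> (\<sigma> \<alpha> n). A \<inter> B \<notin> Fin_ideal \<sigma> (\<sigma> \<alpha> n) \<longrightarrow>
          {t. h n # t \<in> X} \<inter> G n A \<notin> Fin_ideal \<sigma> (\<sigma> \<beta> (h n)))" for n
    proof (cases "n \<in> N")
      case True
      have "{s. n # s \<in> seqs \<sigma> \<alpha>} = seqs \<sigma> (\<sigma> \<alpha> n)" by (auto simp: seqs_rec[OF \<sigma> \<alpha>])
      then have "{t. h n # t \<in> X} \<subseteq> G n (seqs \<sigma> (\<sigma> \<alpha> n))"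
        using X(1) sec[of n "seqs \<sigma> \<alpha>"] by auto
      then show ?thesis using G(5)[of "{t. h n # t \<in> X}" n] True unfolding N_def by blast
    qed blast
    then obtain B where B: "\<And>n. n \<in> N \<Longrightarrow> B n \<subseteq> seqs \<sigma> (\<sigma> \<alpha> n)"
      "\<And>n. n \<in> N \<Longrightarrow> B n \<notin> Fin_ideal \<sigma> (\<sigma> \<alpha> n)"
      "\<And>n A. n \<in> N \<Longrightarrow> A \<subseteq> seqs \<sigma> (\<sigma> \<alpha> n) \<Longrightarrow> A \<inter> B n \<notin> Fin_ideal \<sigma> (\<sigma> \<alpha> n) \<Longrightarrow>
          {t. h n # t \<in> X} \<inter> G n A \<notin> Fin_ideal \<sigma> (\<sigma> \<beta> (h n))"
      by metis
    \<comment> \<open>The shadow of \<open>X\<close> is assembled from shadows of its sections;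
      these exist only at the indices in \<open>N\<close>, where the section of \<open>X\<close> is
      positive.\<close>
    define B' where "B' = {n # s | n s. n \<in> N \<and> s \<in> B n}"
    have B'S: "B' \<subseteq> seqs \<sigma> \<alpha>" using B(1) by (auto simp: B'_def seqs_rec[OF \<sigma> \<alpha>])
    have B'sec: "{s. n # s \<in> B'} = (if n \<in> N then B n else {})" for n by (auto simp: B'_def)
    have "N \<subseteq> {n. {s. n # s \<in> B'} \<notin> Fin_ideal \<sigma> (\<sigma> \<alpha> n)}" using B(2) B'sec by auto
    then have "B' \<notin> Fin_ideal \<sigma> \<alpha>" using N rec\<alpha>[OF B'S] finite_subset by blast
    moreover have "X \<inter> ?F A \<notin> Fin_ideal \<sigma> \<beta>"
      if A: "A \<subseteq> seqs \<sigma> \<alpha>" "A \<inter> B' \<notin> Fin_ideal \<sigma> \<alpha>" for A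
    proof -
      have "A \<inter> B' \<subseteq> seqs \<sigma> \<alpha>" using A(1) by blast
      then have "infinite {n. {s. n # s \<in> A \<inter> B'} \<notin> Fin_ideal \<sigma> (\<sigma> \<alpha> n)}"
        using A(2) rec\<alpha> by blast
      moreover have "{n. {s. n # s \<in> A \<inter> B'} \<notin> Fin_ideal \<sigma> (\<sigma> \<alpha> n)} \<subseteq>
          {n. {t. h n # t \<in> X \<inter> ?F A} \<notin> Fin_ideal \<sigma> (\<sigma> \<beta> (h n))}"
      proof (rule Collect_mono, rule impI)
        fix n assume n: "{s. n # s \<in> A \<inter> B'} \<notin> Fin_ideal \<sigma> (\<sigma> \<alpha> n)"
        have eq: "{s. n # s \<in> A \<inter> B'} = {s. n # s \<in> A} \<inter> (if n \<in> N then B n else {})"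
          unfolding B'sec[symmetric] by blast
        \<comment> \<open>Outside \<open>N\<close> the section of \<open>B'\<close> is empty, so it
          cannot contribute a positive section.\<close>
        have nN: "n \<in> N"
        proof (rule ccontr)
          assume "n \<notin> N"
          then have "{s. n # s \<in> A \<inter> B'} = {}" unfolding eq by (simp only: if_False Int_empty_right)
          then show False
            using n empty_in_Fin_ideal[OF \<sigma> ladder_sequence_bounds(1)[OF \<sigma> \<alpha>]] by (simp only: simp_thms)
        qed
        have "{t. h n # t \<in> X} \<inter> G n {s. n # s \<in> A} \<notin> Fin_ideal \<sigma> (\<sigma> \<beta> (h n))"
          by (rule B(3)[OF nN sec\<alpha>[OF A(1)] n[unfolded eq if_P[OF nN]]])
        moreover have "{t. h n # t \<in> X \<inter> ?F A} = {t. h n # t \<in> X} \<inter> G n {s. n # s \<in> A}"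
          by (subst sec[of n A, symmetric]) blast
        ultimately show "{t. h n # t \<in> X \<inter> ?F A} \<notin> Fin_ideal \<sigma> (\<sigma> \<beta> (h n))" by (simp only: simp_thms)
      qed
      moreover have "X \<inter> ?F A \<subseteq> ?F (seqs \<sigma> \<alpha>)" using X(1) by blast
      ultimately show ?thesis using positive_iff finite_subset by blast
    qed
    ultimately show ?thesis using B'S by blast
  qed
  show ?thesis by (rule pullback_mapI[OF sub positive Int shadow])
qed

text \<open>The induction on \<open>\<alpha>\<close> leaves \<open>\<beta>\<close> arbitrary because
  its hypothesis is applied to pairs \<open>\<sigma> \<alpha> n\<close> and
  \<open>\<sigma> \<beta> (h n)\<close>. These may coincide, so the case of equality has to be
  included.\<close>

lemma ex_pullback_map:
  assumes \<sigma>: "ladder_sequence \<sigma>" and "1 \<le> \<alpha>" "\<alpha> \<le> \<beta>"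
  shows "\<exists>F. pullback_map (seqs \<sigma> \<alpha>) (Fin_ideal \<sigma> \<alpha>) (seqs \<sigma> \<beta>) (Fin_ideal \<sigma> \<beta>) F"
  using assms(2,3)
proof (induction \<alpha> arbitrary: \<beta> rule: less_induct)
  case (less \<alpha>)
  consider "\<alpha> = \<beta>" | "\<alpha> = 1" "1 < \<beta>" | "1 < \<alpha>" "\<alpha> < \<beta>" using less.prems by fastforce
  then show ?case
  proof cases
    case 1
    \<comment> \<open>For the identity, every positive \<open>X\<close> is its own shadow.\<close>
    have "pullback_map (seqs \<sigma> \<alpha>) (Fin_ideal \<sigma> \<alpha>) (seqs \<sigma> \<alpha>) (Fin_ideal \<sigma> \<alpha>) (\<lambda>A. A)"
      unfolding pullback_map_def by (auto simp: Int_commute)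
    then show ?thesis using 1 by blast
  next
    case 2
    then show ?thesis using pullback_map_first_coordinate[OF \<sigma>] by blast
  next
    case 3
    then have \<beta>: "1 < \<beta>" by simp
    note inf = ladder_sequence_infinite_above[OF \<sigma> \<beta> 3(2)]
    \<comment> \<open>The bound \<open>\<alpha>\<close> is uniform in \<open>n\<close> and dominates
      every \<open>\<sigma> \<alpha> n\<close>, so any injective enumeration of these indices pairs
      the sections suitably.\<close>
    define h where "h = enumerate {m. \<alpha> \<le> \<sigma> \<beta> m}"
    have "inj h" unfolding h_def
      using strict_mono_enumerate[OF inf] by (rule strict_mono_imp_inj_on)
    have "\<alpha> \<le> \<sigma> \<beta> (h n)" for n using enumerate_in_set[OF inf] unfolding h_def by blast
    then have "\<sigma> \<alpha> n \<le> \<sigma> \<beta> (h n)" for n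
      using ladder_sequence_bounds(2)[OF \<sigma> 3(1), of n] by (meson less_imp_le order_trans)
    then have "\<exists>F. pullback_map (seqs \<sigma> (\<sigma> \<alpha> n)) (Fin_ideal \<sigma> (\<sigma> \<alpha> n))
      (seqs \<sigma> (\<sigma> \<beta> (h n))) (Fin_ideal \<sigma> (\<sigma> \<beta> (h n))) F" for n
      using less.IH ladder_sequence_bounds[OF \<sigma> 3(1)] by blast
    then obtain G where "\<And>n. pullback_map (seqs \<sigma> (\<sigma> \<alpha> n)) (Fin_ideal \<sigma> (\<sigma> \<alpha> n))
      (seqs \<sigma> (\<sigma> \<beta> (h n))) (Fin_ideal \<sigma> (\<sigma> \<beta> (h n))) (G n)" by metis
    then show ?thesis using pullback_map_sections[OF \<sigma> 3(1) \<beta> \<open>inj h\<close>] by blast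
  qed
qed

section \<open>Existence of the cardinals and their comparison\<close>

lemma ex_infinite_mad_Fin:
  obtains \<A> where "infinite \<A>" "mad_family (seqs \<sigma> 1) (Fin_ideal \<sigma> 1) \<A>"
proof -
  \<comment> \<open>The pairing function splits the sequences of length one into infinitely many
    disjoint infinite columns; any mad family extending the columns is infinite.\<close>
  define C where "C k = (\<lambda>n. [prod_encode (k, n)]) ` UNIV" for k
  have C: "C k \<subseteq> seqs \<sigma> 1" "infinite (C k)" for k
    unfolding C_def by (auto simp: seqs_1 finite_image_iff inj_on_def)
  have disj: "C k \<inter> C l = {}" if "k \<noteq> l" for k l
    using that unfolding C_def by auto
  have "inj C"
  proof (rule injI)
    fix k l assume "C k = C l"
    then show "k = l" using disj[of k l] C(2)[of l] by (metis finite.emptyI inf.idem)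
  qed
  have "almost_disjoint_family (seqs \<sigma> 1) (Fin_ideal \<sigma> 1) (range C)"
  proof (rule almost_disjoint_familyI)
    show "A \<subseteq> seqs \<sigma> 1 \<and> A \<notin> Fin_ideal \<sigma> 1" if "A \<in> range C" for A
      using that C by (auto simp: Fin_ideal_1)
    show "A \<inter> B \<in> Fin_ideal \<sigma> 1" if AB: "A \<in> range C" "B \<in> range C" "A \<noteq> B" for A B
    proof -
      obtain k l where "A = C k" "B = C l" using AB by auto
      then have "A \<inter> B = {}" using AB(3) disj by metis
      then show ?thesis by (simp add: Fin_ideal_1)
    qed
  qed
  then obtain \<A> where "range C \<subseteq> \<A>" "mad_family (seqs \<sigma> 1) (Fin_ideal \<sigma> 1) \<A>"
    by (rule mad_family_extends)
  then show ?thesis using that range_inj_infinite[OF \<open>inj C\<close>] finite_subset by blast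
qed

text \<open>This serves twice: from index 1 it yields infinite mad families at every index, and from
  a family of least size it yields the inequality of cardinals.\<close>

lemma mad_family_Fin_ideal_transfer:
  assumes "ladder_sequence \<sigma>" "1 \<le> \<alpha>" "\<alpha> \<le> \<beta>"
    and "infinite \<A>" "mad_family (seqs \<sigma> \<alpha>) (Fin_ideal \<sigma> \<alpha>) \<A>"
  obtains \<B> where "infinite \<B>" "mad_family (seqs \<sigma> \<beta>) (Fin_ideal \<sigma> \<beta>) \<B>" "|\<B>| \<le>o |\<A>|"
proof -
  obtain F where F: "pullback_map (seqs \<sigma> \<alpha>) (Fin_ideal \<sigma> \<alpha>) (seqs \<sigma> \<beta>) (Fin_ideal \<sigma> \<beta>) F"
    using ex_pullback_map[OF assms(1-3)] by blast
  have \<beta>: "1 \<le> \<beta>" using assms(2,3) by (rule order_trans)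
  show ?thesis
    by (rule mad_family_pullback[OF F Fin_ideal_mono[OF assms(1) \<beta>]
      Fin_ideal_Un[OF assms(1) \<beta>] assms(4,5)]) (auto intro: that)
qed

text \<open>The choice in \<open>ad_number\<close> is meaningful only if an infinite mad family
  exists; one is carried over from index 1.\<close>

lemma is_ad_number_\<aa>:
  assumes "ladder_sequence \<sigma>" "1 \<le> \<alpha>"
  shows "is_ad_number (seqs \<sigma> \<alpha>) (Fin_ideal \<sigma> \<alpha>) (\<aa> \<sigma> \<alpha>)"
proof -
  obtain \<A> where \<A>: "infinite \<A>" "mad_family (seqs \<sigma> 1) (Fin_ideal \<sigma> 1) \<A>"
    by (rule ex_infinite_mad_Fin)
  obtain \<B> where "infinite \<B>" "mad_family (seqs \<sigma> \<alpha>) (Fin_ideal \<sigma> \<alpha>) \<B>"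
    by (rule mad_family_Fin_ideal_transfer[OF assms(1) order_refl assms(2) \<A>])
  then show ?thesis unfolding \<aa>_def by (rule is_ad_number_ad_number)
qed

theorem corollary3p8:
  fixes \<sigma> :: "omega1 \<Rightarrow> nat \<Rightarrow> omega1" and \<alpha> \<beta> :: omega1
  assumes "ladder_sequence \<sigma>"
    and "1 \<le> \<alpha>" and "\<alpha> < \<beta>"
  shows "\<aa> \<sigma> \<beta> \<le>o \<aa> \<sigma> \<alpha>"
proof -
  have \<beta>: "1 \<le> \<beta>" "\<alpha> \<le> \<beta>" using assms(2,3) by auto
  \<comment> \<open>A family of least size at \<open>\<alpha>\<close> is moved to
    \<open>\<beta>\<close>, where minimality bounds the cardinal by the size of the result.\<close>
  obtain \<A> where \<A>: "infinite \<A>" "mad_family (seqs \<sigma> \<alpha>) (Fin_ideal \<sigma> \<alpha>) \<A>"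
    "|\<A>| =o \<aa> \<sigma> \<alpha>"
    using is_ad_number_\<aa>[OF assms(1,2)] unfolding is_ad_number_def by blast
  obtain \<B> where \<B>: "infinite \<B>" "mad_family (seqs \<sigma> \<beta>) (Fin_ideal \<sigma> \<beta>) \<B>" "|\<B>| \<le>o |\<A>|"
    by (rule mad_family_Fin_ideal_transfer[OF assms(1,2) \<beta>(2) \<A>(1,2)])
  have "\<aa> \<sigma> \<beta> \<le>o |\<B>|"
    using is_ad_number_\<aa>[OF assms(1) \<beta>(1)] \<B>(1,2) unfolding is_ad_number_def by blast
  then show ?thesis
    using \<B>(3) \<A>(3) ordLeq_transitive ordLeq_ordIso_trans by blast
qed

end
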